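(* There exists a transcendental entire function $g$ such that the antiholomorphic flow $\dot z = \overline{g(z)}$ has no trajectories tending to infinity in finite increasing time.
   Context: A trajectory of the flow $\dot z = \overline{g(z)}$ is a path $z(t)$ with $z'(t) = \overline{g(z(t))}$ for $t$ in a maximal interval $(\alpha,\beta)\subseteq\mathbb{R}$. It tends to infinity in finite increasing time if $\beta<+\infty$ and $z(t) \to \infty$ as $t \to \beta^-$. *)

theory Defs
  imports "HOL-Complex_Analysis.Complex_Analysis" "HOL-Computational_Algebra.Polynomial"
begin

definition transcendental_entire :: "(complex \<Rightarrow> complex) \<Rightarrow> bool" where
  "transcendental_entire g \<longleftrightarrow>
     g holomorphic_on UNIV \<and> \<not> (\<exists>p :: complex poly. \<forall>z. g z = poly p z)"

definition solves_on :: "(complex \<Rightarrow> complex) \<Rightarrow> (real \<Rightarrow> complex) \<Rightarrow> ereal \<Rightarrow> ereal \<Rightarrow> bool" where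
  "solves_on g z a b \<longleftrightarrow> a < b \<and>
     (\<forall>t. a < ereal t \<and> ereal t < b \<longrightarrow> (z has_vector_derivative cnj (g (z t))) (at t))"

definition trajectory :: "(complex \<Rightarrow> complex) \<Rightarrow> (real \<Rightarrow> complex) \<Rightarrow> ereal \<Rightarrow> ereal \<Rightarrow> bool" where
  "trajectory g z a b \<longleftrightarrow> solves_on g z a b \<and>
     (\<forall>a' b' w. a' \<le> a \<and> b \<le> b' \<and> (a' < a \<or> b < b') \<and> solves_on g w a' b' \<longrightarrow>
        \<not> (\<forall>t. a < ereal t \<and> ereal t < b \<longrightarrow> w t = z t))"

definition escapes_in_finite_time :: "(real \<Rightarrow> complex) \<Rightarrow> ereal \<Rightarrow> bool" where
  "escapes_in_finite_time z b \<longleftrightarrow>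
     b < \<infinity> \<and> filterlim z at_infinity (at_left (real_of_ereal b))"

end

theory Submission
  imports Defs "HOL-Computational_Algebra.Fundamental_Theorem_Algebra"
begin

text \<open>
  Write \<open>g = deriv G\<close>. Along a trajectory \<open>Im G\<close> is constant and \<open>Re G\<close> increases, so from some
  point on a trajectory stays where \<open>\<bar>Im G\<bar> \<le> n\<close> and \<open>Re G \<ge> -n\<close>, for every large \<open>n\<close>. It therefore
  suffices that on its way to infinity such a trajectory has to cross, for arbitrarily large \<open>n\<close>, an
  annulus of width 1 in a region where \<open>\<bar>g\<bar> \<le> 1\<close>: each crossing takes time at least 1.

  \<open>G\<close> is a locally uniform limit of polynomials, each obtained from its predecessor \<open>P\<close> as
  \<open>Q = F \<circ> P\<close>, where the polynomial \<open>F\<close> approximates \<open>L(w) = \<tau> Ln (1 + w/\<tau>)\<close> on a huge disc that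
  has the real interval from \<open>-s\<close> to \<open>2c + s\<close> as a diameter, with \<open>s < \<tau>\<close>. Near 0 the map \<open>L\<close> is close
  to the identity, so \<open>Q\<close> is close to \<open>P\<close> there. The condition on \<open>Im G\<close> and \<open>Re G\<close> prevents \<open>w = P(z)\<close>
  from reaching the line \<open>Re w = -s/2\<close>, and for large \<open>z\<close> on the right of it
  \<open>\<bar>Q'\<bar> = \<bar>F'(w) P'(z)\<bar>\<close> is about \<open>\<tau> \<bar>P'(z) / P(z)\<bar>\<close>, which tends to 0.
\<close>

section \<open>Flow lines and slow barriers\<close>

text \<open>Let \<open>t2\<close> be the first time with norm at least \<open>\<rho> + 1\<close> and
  \<open>t1\<close> the last time before it with norm at most \<open>\<rho>\<close>. In between, a
  distance of at least 1 is covered at speed at most 1. The hypothesis \<open>slow\<close> grants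
  the whole history up to \<open>t\<close> inside the larger ball, because the barrier argument must
  trace the path back to its start.\<close>

lemma crossing_time:
  fixes z :: "real \<Rightarrow> complex"
  assumes z': "\<And>t. t0 \<le> t \<Longrightarrow> t \<le> u \<Longrightarrow> (z has_vector_derivative z' t) (at t)"
    and start: "norm (z t0) \<le> \<rho>" and stop: "norm (z u) \<ge> \<rho> + 1" and "t0 \<le> u"
    and slow: "\<And>t. t0 \<le> t \<Longrightarrow> t \<le> u \<Longrightarrow> \<rho> \<le> norm (z t) \<Longrightarrow>
      (\<And>s. t0 \<le> s \<Longrightarrow> s \<le> t \<Longrightarrow> norm (z s) \<le> \<rho> + 1) \<Longrightarrow> norm (z' t) \<le> 1"
  shows "1 \<le> u - t0"
proof -
  have cont: "continuous_on {t0..u} z"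
    by (meson z' atLeastAtMost_iff continuous_at_imp_continuous_on has_vector_derivative_continuous)
  define S where "S = {t0..u} \<inter> (\<lambda>t. norm (z t)) -` {\<rho> + 1..}"
  have "closed S"
    unfolding S_def by (intro continuous_closed_preimage continuous_intros cont)
  then have "compact S"
    unfolding S_def by (meson bounded_Int bounded_closed_interval compact_eq_bounded_closed)
  moreover have "u \<in> S" using stop \<open>t0 \<le> u\<close> by (auto simp: S_def)
  ultimately obtain t2 where t2: "t2 \<in> S" "\<And>t. t \<in> S \<Longrightarrow> t2 \<le> t"
    using compact_attains_inf by (metis empty_iff)
  then have t2_in: "t0 \<le> t2" "t2 \<le> u" "norm (z t2) \<ge> \<rho> + 1" by (auto simp: S_def)
  have before: "norm (z t) < \<rho> + 1" if "t0 \<le> t" "t < t2" for t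
    using t2(2)[of t] that t2_in by (force simp: S_def)
  have cont2: "continuous_on {t0..t2} z" 
    using cont t2_in by (auto intro: continuous_on_subset)
  define R where "R = {t0..t2} \<inter> (\<lambda>t. norm (z t)) -` {..\<rho>}"
  have "closed R"
    unfolding R_def by (intro continuous_closed_preimage continuous_intros cont2)
  then have "compact R"
    unfolding R_def by (meson bounded_Int bounded_closed_interval compact_eq_bounded_closed)
  moreover have "t0 \<in> R" using start t2_in by (auto simp: R_def)
  ultimately obtain t1 where t1: "t1 \<in> R" "\<And>t. t \<in> R \<Longrightarrow> t \<le> t1"
    using compact_attains_sup by (metis empty_iff)
  then have t1_in: "t0 \<le> t1" "t1 \<le> t2" "norm (z t1) \<le> \<rho>" by (auto simp: R_def)
  have "t1 \<noteq> t2" using t1_in t2_in by force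
  then have "t1 < t2" using t1_in by simp
  have after: "\<rho> < norm (z t)" if "t1 < t" "t \<le> t2" for t
    using t1(2)[of t] that t1_in by (force simp: R_def)
  have "\<exists>t\<in>{t1<..<t2}. norm (z t2 - z t1) \<le> norm ((t2 - t1) *\<^sub>R z' t)"
  proof (rule mvt_general[OF \<open>t1 < t2\<close>])
    show "continuous_on {t1..t2} z"
      using cont2 t1_in by (auto intro: continuous_on_subset)
    show "(z has_derivative (\<lambda>s. s *\<^sub>R z' t)) (at t)" if "t1 < t" "t < t2" for t
      using z'[of t] that t1_in t2_in by (simp add: has_vector_derivative_def)
  qed
  then obtain t where t: "t1 < t" "t < t2" "norm (z t2 - z t1) \<le> norm ((t2 - t1) *\<^sub>R z' t)"
    by auto
  have "norm (z' t) \<le> 1"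
    using t t1_in t2_in after[of t] by (intro slow) (auto intro!: less_imp_le[OF before])
  have "norm (z t2 - z t1) \<le> (t2 - t1) * norm (z' t)"
    using t(3) \<open>t1 < t2\<close> by simp
  also have "\<dots> \<le> (t2 - t1) * 1"
    using \<open>norm (z' t) \<le> 1\<close> \<open>t1 < t2\<close> by (intro mult_left_mono) auto
  finally have "norm (z t2 - z t1) \<le> t2 - t1" by simp
  moreover have "norm (z t2) \<le> norm (z t1) + norm (z t2 - z t1)"
    by (metis add.commute diff_add_cancel norm_triangle_ineq)
  ultimately show ?thesis using t1_in t2_in by linarith
qed

text \<open>
  The set \<open>h > 0\<close> contains the disc of radius \<open>n\<close>; while \<open>norm z \<le> \<rho> + 1\<close>, a trajectory with
  \<open>\<bar>Im G\<bar> \<le> n\<close> and \<open>Re G \<ge> -n\<close> cannot leave it, and in the annulus it is slow there.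
\<close>

definition slow_barrier :: "nat \<Rightarrow> (complex \<Rightarrow> complex) \<Rightarrow> bool" where
  "slow_barrier n G \<longleftrightarrow> (\<exists>(h :: complex \<Rightarrow> real) \<rho>. continuous_on UNIV h \<and> real n \<le> \<rho> \<and>
     (\<forall>z. norm z \<le> n \<longrightarrow> h z > 0) \<and>
     (\<forall>z. norm z \<le> \<rho> + 1 \<longrightarrow> h z = 0 \<longrightarrow> \<bar>Im (G z)\<bar> \<le> n \<longrightarrow> Re (G z) < - real n) \<and>
     (\<forall>z. \<rho> \<le> norm z \<longrightarrow> norm z \<le> \<rho> + 1 \<longrightarrow> h z \<ge> 0 \<longrightarrow> norm (deriv G z) \<le> 1))"

text \<open>By the chain rule, \<open>G\<close> along the path has derivative
  \<open>cnj g * g\<close>, the square of \<open>norm g\<close>, which is real and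
  nonnegative.\<close>

lemma gradient_flow_primitive:
  assumes G: "G holomorphic_on UNIV" and "t0 \<le> t"
    and z: "\<And>s. t0 \<le> s \<Longrightarrow> s \<le> t \<Longrightarrow> (z has_vector_derivative cnj (deriv G (z s))) (at s)"
  shows "Im (G (z t)) = Im (G (z t0))" "Re (G (z t0)) \<le> Re (G (z t))"
proof -
  have D: "((\<lambda>s. G (z s)) has_vector_derivative complex_of_real ((norm (deriv G (z s)))\<^sup>2)) (at s)"
    if "t0 \<le> s" "s \<le> t" for s
  proof -
    have "(G has_field_derivative deriv G (z s)) (at (z s))"
      using G by (simp add: holomorphic_derivI)
    then have "((G \<circ> z) has_vector_derivative cnj (deriv G (z s)) * deriv G (z s)) (at s)"
      using z[OF that] by (rule field_vector_diff_chain_at[rotated])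
    moreover have "cnj (deriv G (z s)) * deriv G (z s) = complex_of_real ((norm (deriv G (z s)))\<^sup>2)"
      by (metis complex_norm_square mult.commute)
    ultimately show ?thesis by (simp add: o_def)
  qed
  show "Re (G (z t0)) \<le> Re (G (z t))"
  proof (rule DERIV_nonneg_imp_nondecreasing[OF \<open>t0 \<le> t\<close>])
    fix s assume s: "t0 \<le> s" "s \<le> t"
    have "((\<lambda>s. Re (G (z s))) has_real_derivative (norm (deriv G (z s)))\<^sup>2) (at s)"
      using bounded_linear.has_vector_derivative[OF bounded_linear_Re D[OF s]] by (simp add: has_real_derivative_iff_has_vector_derivative)
    then show "\<exists>y. ((\<lambda>s. Re (G (z s))) has_real_derivative y) (at s) \<and> 0 \<le> y" by force
  qed
  have Im0: "((\<lambda>s. Im (G (z s))) has_real_derivative 0) (at s)" if "t0 \<le> s" "s \<le> t" for s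
    using bounded_linear.has_vector_derivative[OF bounded_linear_Im D[OF that]] by (simp add: has_real_derivative_iff_has_vector_derivative)
  show "Im (G (z t)) = Im (G (z t0))"
  proof (rule antisym)
    show "Im (G (z t0)) \<le> Im (G (z t))"
      by (rule DERIV_nonneg_imp_nondecreasing[OF \<open>t0 \<le> t\<close>]) (use Im0 in blast)
    show "Im (G (z t)) \<le> Im (G (z t0))"
      by (rule DERIV_nonpos_imp_nonincreasing[OF \<open>t0 \<le> t\<close>]) (use Im0 in blast)
  qed
qed

text \<open>An escaping solution would have to cross the slow annulus in the time left before
  \<open>\<beta>\<close>, which is less than 1 if \<open>t0\<close> is chosen late enough. This
  contradicts \<open>crossing_time\<close>.\<close>

lemma slow_barriers_imp_not_escape:
  assumes G: "G holomorphic_on UNIV" and barrier: "\<And>m. \<exists>n\<ge>m. slow_barrier n G"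
    and sol: "solves_on (deriv G) z a b"
  shows "\<not> escapes_in_finite_time z b"
proof
  assume esc: "escapes_in_finite_time z b"
  obtain \<beta> where \<beta>: "b = ereal \<beta>"
    using sol esc by (cases b) (auto simp: solves_on_def escapes_in_finite_time_def)
  have "a < b" and z: "\<And>t. a < ereal t \<Longrightarrow> ereal t < b \<Longrightarrow> (z has_vector_derivative cnj (deriv G (z t))) (at t)"
    using sol by (auto simp: solves_on_def)
  have "max a (ereal (\<beta> - 1)) < ereal \<beta>" using \<open>a < b\<close> \<beta> by simp
  then obtain t0 where t0: "a < ereal t0" "\<beta> - 1 < t0" "t0 < \<beta>"
    using ereal_dense2[of "max a (ereal (\<beta> - 1))" "ereal \<beta>"] by (metis less_ereal.simps(1) max_less_iff_conj)
  have z0: "(z has_vector_derivative cnj (deriv G (z t))) (at t)" if "t0 \<le> t" "t < \<beta>" for t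
    using that t0 \<beta> by (intro z) (auto intro: less_le_trans)
  \<comment> \<open>Bounding \<open>z t0\<close> puts the start where \<open>h > 0\<close>. Bounding
    \<open>G (z t0)\<close> gives the conditions on \<open>Im G\<close> and \<open>Re G\<close>,
    which then persist along the flow.\<close>
  obtain m where m: "norm (z t0) + norm (G (z t0)) \<le> real m"
    using real_arch_simple by blast
  obtain n where "m \<le> n" and bar: "slow_barrier n G"
    using barrier by blast
  with m have n: "norm (z t0) + norm (G (z t0)) \<le> real n" by linarith
  obtain h \<rho> where h: "continuous_on UNIV (h :: complex \<Rightarrow> real)" "real n \<le> \<rho>"
    "\<And>w. norm w \<le> n \<Longrightarrow> h w > 0"
    "\<And>w. norm w \<le> \<rho> + 1 \<Longrightarrow> h w = 0 \<Longrightarrow> \<bar>Im (G w)\<bar> \<le> n \<Longrightarrow> Re (G w) < - real n"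
    "\<And>w. \<rho> \<le> norm w \<Longrightarrow> norm w \<le> \<rho> + 1 \<Longrightarrow> h w \<ge> 0 \<Longrightarrow> norm (deriv G w) \<le> 1"
    using bar unfolding slow_barrier_def by blast
  have "filterlim z at_infinity (at_left \<beta>)"
    using esc by (simp add: escapes_in_finite_time_def \<beta>)
  then have "\<forall>\<^sub>F t in at_left \<beta>. \<rho> + 1 \<le> norm (z t)"
    using h(2) by (auto simp: filterlim_at_infinity[of 0])
  moreover have "\<forall>\<^sub>F t in at_left \<beta>. t \<in> {t0<..<\<beta>}"
    using t0(3) by (rule eventually_at_left_real)
  ultimately have "\<forall>\<^sub>F t in at_left \<beta>. \<rho> + 1 \<le> norm (z t) \<and> t \<in> {t0<..<\<beta>}"
    by (rule eventually_conj)
  then obtain u where u: "\<rho> + 1 \<le> norm (z u)" "t0 < u" "u < \<beta>"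
    using eventually_happens' trivial_limit_at_left_real by fastforce
  have "1 \<le> u - t0"
  proof (rule crossing_time[where z' = "\<lambda>t. cnj (deriv G (z t))"])
    fix t assume t: "t0 \<le> t" "t \<le> u" "\<rho> \<le> norm (z t)"
      "\<And>s. t0 \<le> s \<Longrightarrow> s \<le> t \<Longrightarrow> norm (z s) \<le> \<rho> + 1"
    have "h (z t) > 0"
    \<comment> \<open>Otherwise \<open>h\<close> vanishes somewhere on the path by the intermediate
      value theorem. There the barrier forces \<open>Re G < - n\<close>, although
      \<open>Re G\<close> started at \<open>- n\<close> or above and cannot decrease.\<close>
    proof (rule ccontr)
      assume "\<not> h (z t) > 0"
      moreover have "h (z t0) > 0"
        using n by (intro h) (smt (verit) norm_ge_zero)
      moreover have "continuous_on {t0..t} (\<lambda>s. h (z s))"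
      proof (rule continuous_on_compose2[OF h(1)])
        show "continuous_on {t0..t} z"
          using t u by (intro continuous_at_imp_continuous_on ballI
            has_vector_derivative_continuous[OF z0]) auto
      qed simp
      ultimately obtain s where s: "t0 \<le> s" "s \<le> t" "h (z s) = 0"
        using IVT2'[of "\<lambda>s. h (z s)" t 0 t0] t by force
      have "Im (G (z s)) = Im (G (z t0))" "Re (G (z t0)) \<le> Re (G (z s))"
        using gradient_flow_primitive[OF G s(1), of z] z0 s t u by auto
      moreover have "\<bar>Im (G (z t0))\<bar> \<le> n" "- real n \<le> Re (G (z t0))"
        using n abs_Im_le_cmod[of "G (z t0)"] abs_Re_le_cmod[of "G (z t0)"] norm_ge_zero[of "z t0"]
        by linarith+
      ultimately show False using h(4)[of "z s"] s t(4) by force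
    qed
    then show "norm (cnj (deriv G (z t))) \<le> 1"
      using h(5)[of "z t"] t by simp
  next
    show "norm (z t0) \<le> \<rho>" using n h(2) norm_ge_zero[of "G (z t0)"] by linarith
  qed (use u z0 in auto)
  then show False using t0 u by linarith
qed

section \<open>The scaled logarithm and its polynomial approximation\<close>

text \<open>With \<open>l = Ln (1 + w / \<tau>)\<close> and \<open>x = a / \<tau>\<close>, the real
  part of \<open>1 + w / \<tau>\<close> is \<open>exp (Re l) * cos (Im l)\<close>. Both factors are
  at least \<open>1 - x\<close>, and the square of \<open>1 - x\<close> is at least
  \<open>1 - 2 * x\<close>.\<close>

lemma Re_ge_of_scaled_Ln:
  fixes w :: complex and \<tau> a :: real
  assumes "0 < \<tau>" "0 \<le> a" "a \<le> \<tau>" "1 + w / \<tau> \<noteq> 0"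
    and Im: "\<bar>Im (\<tau> * Ln (1 + w / \<tau>))\<bar> \<le> a" and Re: "- a \<le> Re (\<tau> * Ln (1 + w / \<tau>))"
  shows "- (2 * a) \<le> Re w"
proof -
  define l where "l = Ln (1 + w / \<tau>)"
  define x where "x = a / \<tau>"
  have x: "0 \<le> x" "x \<le> 1" using assms by (auto simp: x_def)
  have "\<bar>Im l\<bar> \<le> x" "- x \<le> Re l"
    using Im Re \<open>0 < \<tau>\<close> by (auto simp: l_def x_def field_simps abs_mult)
  have "1 - x \<le> cos (Im l)"
  proof -
    have "cos (Im l) = 1 - 2 * (sin (Im l / 2))\<^sup>2"
      using cos_double_sin[of "Im l / 2"] by simp
    moreover have "(sin (Im l / 2))\<^sup>2 \<le> (x / 2)\<^sup>2"
      using abs_sin_x_le_abs_x[of "Im l / 2"] \<open>\<bar>Im l\<bar> \<le> x\<close> x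
      by (intro power2_le_iff_abs_le[THEN iffD2]) auto
    moreover have "x\<^sup>2 \<le> x" using x by (simp add: power2_eq_square mult_left_le)
    ultimately show ?thesis using x by (simp add: power_divide)
  qed
  moreover have "1 - x \<le> exp (Re l)"
    using exp_ge_add_one_self[of "Re l"] \<open>- x \<le> Re l\<close> by linarith
  ultimately have "(1 - x) * (1 - x) \<le> exp (Re l) * cos (Im l)"
    using x by (intro mult_mono) auto
  also have "\<dots> = Re (exp l)" by (simp add: Re_exp)
  also have "exp l = 1 + w / \<tau>" unfolding l_def using assms by simp
  also have "Re (1 + w / \<tau>) = 1 + Re w / \<tau>" by simp
  finally have "1 - 2 * x + x * x \<le> 1 + Re w / \<tau>" by (simp add: algebra_simps)
  moreover have "0 \<le> x * x" by simp
  ultimately have "- (2 * x) \<le> Re w / \<tau>" by linarith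
  then show ?thesis using \<open>0 < \<tau>\<close> by (simp add: x_def field_simps)
qed

text \<open>
  The derivative of \<open>F\<close> is a partial sum of the geometric series for \<open>\<tau> / (\<tau> + w)\<close> centred at \<open>c\<close>.
\<close>

lemma ex_poly_deriv_approx_reciprocal:
  fixes c s \<tau> \<epsilon> :: real and N :: nat
  assumes "0 \<le> c" "0 < s" "s < \<tau>" "0 < \<epsilon>"
  obtains F :: "complex poly" where "N < degree F" "poly F 0 = 0"
    "\<And>w :: complex. w \<in> cball (of_real c) (c + s) \<Longrightarrow> norm (poly (pderiv F) w - \<tau> / (\<tau> + w)) \<le> \<epsilon>"
proof -
  \<comment> \<open>The coefficients make the derivative of the \<open>k\<close>-th summand equal to
    \<open>- (c - w) ^ k / (\<tau> + c) ^ Suc k\<close>, a term of the geometric series for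
    \<open>- 1 / (\<tau> + w)\<close>. The factor \<open>- \<tau>\<close> enters only in
    \<open>F\<close>.\<close>
  define b :: "nat \<Rightarrow> complex" where "b k = 1 / (of_nat (Suc k) * (\<tau> + c) ^ Suc k)" for k
  define f :: "nat \<Rightarrow> complex poly" where "f m = (\<Sum>k<m. smult (b k) ([:of_real c, - 1:] ^ Suc k))" for m
  have \<tau>c: "\<tau> + c > 0" "complex_of_real \<tau> + of_real c \<noteq> 0"
    using assms by (auto simp flip: of_real_add)
  have b0: "b k \<noteq> 0" for k
    using \<tau>c unfolding b_def by (simp del: of_nat_Suc)
  have deg: "degree (f m) = m" for m
  proof (induction m)
    case (Suc m)
    have "degree (smult (b m) ([:of_real c, - 1:] ^ Suc m)) = Suc m"
      using b0 by (simp add: degree_power_eq del: power_Suc)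
    then have "degree (f m + smult (b m) ([:of_real c, - 1:] ^ Suc m)) = Suc m"
      using Suc by (subst degree_add_eq_right) simp_all
    then show ?case by (simp add: f_def)
  qed (simp add: f_def)
  have pderiv_f: "poly (pderiv (f m)) w * (\<tau> + w) = ((c - w) / (\<tau> + c)) ^ m - 1" for m and w :: complex
  proof (induction m)
    case (Suc m)
    have "poly (pderiv (smult (b m) ([:of_real c, - 1:] ^ Suc m))) w = - ((c - w) ^ m / (\<tau> + c) ^ Suc m)"
      by (simp add: b_def pderiv_smult pderiv_power_Suc pderiv_pCons del: of_nat_Suc power_Suc)
    moreover have "f (Suc m) = f m + smult (b m) ([:of_real c, - 1:] ^ Suc m)"
      by (simp add: f_def)
    ultimately have "poly (pderiv (f (Suc m))) w * (\<tau> + w)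
        = ((c - w) / (\<tau> + c)) ^ m - 1 - (c - w) ^ m / (\<tau> + c) ^ Suc m * (\<tau> + w)"
      using Suc by (simp add: pderiv_add algebra_simps)
    also have "\<dots> = ((c - w) / (\<tau> + c)) ^ Suc m - 1"
    proof -
      have *: "x / A - 1 - x / (q * A) * (q - d) = d / q * (x / A) - 1" if "q \<noteq> 0" for x A q d :: complex
        using that by (cases "A = 0") (simp_all add: field_simps)
      have eq: "\<tau> + w = (\<tau> + c) - (c - w)" by simp
      show ?thesis
        unfolding eq using *[OF \<tau>c(2), of "(c - w) ^ m" "(\<tau> + c) ^ m" "c - w"] by (simp only: power_divide power_Suc of_real_add of_real_mult of_real_power)
    qed
    finally show ?case .
  qed (simp add: f_def)
  \<comment> \<open>On the disc, \<open>q\<close> bounds the modulus of the ratio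
    \<open>(c - w) / (\<tau> + c)\<close>. It is below 1 because the pole \<open>- \<tau>\<close>
    lies outside the disc.\<close>
  define q where "q = (c + s) / (\<tau> + c)"
  have "0 \<le> q" "q < 1" using assms by (auto simp: q_def)
  then have "(\<lambda>m. \<tau> / (\<tau> - s) * q ^ m) \<longlonglongrightarrow> 0"
    by (intro tendsto_mult_right_zero LIMSEQ_power_zero) simp
  then have "\<forall>\<^sub>F m in sequentially. \<tau> / (\<tau> - s) * q ^ m < \<epsilon>"
    using \<open>0 < \<epsilon>\<close> by (rule order_tendstoD)
  then have "\<forall>\<^sub>F m in sequentially. \<tau> / (\<tau> - s) * q ^ m < \<epsilon> \<and> N < m"
    using eventually_gt_at_top by (rule eventually_conj)
  then obtain m where m: "\<tau> / (\<tau> - s) * q ^ m < \<epsilon>" "N < m"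
    using eventually_happens' sequentially_bot by blast
  define F where "F = smult (- \<tau>) (f m) - [:poly (smult (- \<tau>) (f m)) 0:]"
  show thesis
  proof (rule that)
    show "N < degree F"
      using m assms unfolding F_def by (subst diff_conv_add_uminus, subst degree_add_eq_left) (simp_all add: deg)
    show "poly F 0 = 0" by (simp add: F_def)
    fix w :: complex assume w: "w \<in> cball (of_real c) (c + s)"
    have "\<bar>Re (of_real c - w)\<bar> \<le> c + s"
      using w abs_Re_le_cmod[of "of_real c - w"] by (simp add: dist_norm)
    then have "\<tau> - s \<le> norm (\<tau> + w)"
      using complex_Re_le_cmod[of "\<tau> + w"] by simp
    then have nz: "\<tau> + w \<noteq> 0" and pos: "0 < norm (\<tau> + w)" using \<open>s < \<tau>\<close> by auto
    have "pderiv F = smult (- \<tau>) (pderiv (f m))"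
      by (simp add: F_def pderiv_diff pderiv_minus pderiv_smult pderiv_pCons)
    then have "poly (pderiv F) w - \<tau> / (\<tau> + w) = - \<tau> * ((c - w) / (\<tau> + c)) ^ m / (\<tau> + w)"
    proof -
      have *: "- t * p - t / x = - t * q / x" if "p * x = q - 1" "x \<noteq> 0" for p q x t :: complex
      proof -
        have "q = p * x + 1" using that(1) by simp
        then show ?thesis using that(2) by (simp add: field_simps)
      qed
      show ?thesis
        using *[OF pderiv_f[of m w] nz, of "of_real \<tau>"] \<open>pderiv F = _\<close> by simp
    qed
    then have "norm (poly (pderiv F) w - \<tau> / (\<tau> + w)) = \<tau> / norm (\<tau> + w) * (norm (c - w) / (\<tau> + c)) ^ m"
      using assms \<tau>c by (simp add: norm_mult norm_divide norm_power flip: of_real_add)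
    also have "\<dots> \<le> \<tau> / (\<tau> - s) * q ^ m"
      unfolding q_def using assms w \<open>\<tau> - s \<le> norm (\<tau> + w)\<close>
      by (intro mult_mono power_mono divide_left_mono divide_right_mono)
         (auto simp: dist_norm intro!: mult_pos_pos pos divide_nonneg_nonneg)
    also have "\<dots> \<le> \<epsilon>" using m by simp
    finally show "norm (poly (pderiv F) w - \<tau> / (\<tau> + w)) \<le> \<epsilon>" .
  qed
qed

text \<open>The scaled logarithm has derivative \<open>\<tau> / (\<tau> + w)\<close> and vanishes at
  0, as does \<open>F\<close>. The derivative estimate can thus be integrated from 0 inside the
  convex disc, whose points have norm at most \<open>2 * c + s\<close>; hence the choice of
  \<open>\<epsilon>'\<close>.\<close>

lemma ex_poly_approx_scaled_Ln:
  fixes c s \<tau> \<epsilon> :: real and N :: nat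
  assumes "0 \<le> c" "0 < s" "s < \<tau>" "0 < \<epsilon>"
  obtains F :: "complex poly" where "N < degree F"
    "\<And>w :: complex. w \<in> cball (of_real c) (c + s) \<Longrightarrow> norm (poly (pderiv F) w - \<tau> / (\<tau> + w)) \<le> \<epsilon>"
    "\<And>w :: complex. w \<in> cball (of_real c) (c + s) \<Longrightarrow> norm (poly F w - \<tau> * Ln (1 + w / \<tau>)) \<le> \<epsilon>"
proof -
  define D where "D = cball (complex_of_real c) (c + s)"
  define \<epsilon>' where "\<epsilon>' = \<epsilon> / (1 + (2 * c + s))"
  have \<epsilon>': "0 < \<epsilon>'" "\<epsilon>' \<le> \<epsilon>" "\<epsilon>' * (2 * c + s) \<le> \<epsilon>"
    using assms by (auto simp: \<epsilon>'_def field_simps)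
  obtain F :: "complex poly" where F: "N < degree F" "poly F 0 = 0"
    "\<And>w :: complex. w \<in> D \<Longrightarrow> norm (poly (pderiv F) w - \<tau> / (\<tau> + w)) \<le> \<epsilon>'"
    using ex_poly_deriv_approx_reciprocal[OF assms(1-3) \<epsilon>'(1), of N] unfolding D_def by metis
  show thesis
  proof (rule that)
    show "N < degree F" by fact
    fix w assume w: "w \<in> cball (complex_of_real c) (c + s)"
    show "norm (poly (pderiv F) w - \<tau> / (\<tau> + w)) \<le> \<epsilon>"
      using F(3)[of w] w \<epsilon>' by (simp add: D_def)
    have "norm ((poly F w - \<tau> * Ln (1 + w / \<tau>)) - (poly F 0 - \<tau> * Ln (1 + (0 :: complex) / \<tau>))) \<le> \<epsilon>' * norm (w - 0)"
    proof (rule field_differentiable_bound[where S = D])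
      show "w \<in> D" "0 \<in> D" "convex D" using w assms by (auto simp: D_def)
      fix v assume v: "v \<in> D"
      have "\<bar>Re (of_real c - v)\<bar> \<le> c + s"
        using v abs_Re_le_cmod[of "of_real c - v"] by (simp add: D_def dist_norm)
      then have "0 < 1 + Re v / \<tau>" using assms by (simp add: field_simps)
      then have "1 + v / \<tau> \<notin> \<real>\<^sub>\<le>\<^sub>0"
        by (auto simp: complex_nonpos_Reals_iff)
      moreover have "1 / \<tau> / (1 + v / \<tau>) * \<tau> = \<tau> / (\<tau> + v)"
        using assms by (simp add: field_simps)
      ultimately show "((\<lambda>v. poly F v - \<tau> * Ln (1 + v / \<tau>)) has_field_derivative
          poly (pderiv F) v - \<tau> / (\<tau> + v)) (at v within D)"
        using assms by (auto intro!: derivative_eq_intros poly_DERIV[THEN has_field_derivative_at_within] simp: field_simps)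
    qed (use F(3) in blast)
    then have "norm (poly F w - \<tau> * Ln (1 + w / \<tau>)) \<le> \<epsilon>' * norm w"
      using F(2) by simp
    also have "norm w \<le> 2 * c + s"
      using w norm_triangle_ineq2[of w "of_real c"] assms by (simp add: dist_norm norm_minus_commute)
    then have "\<epsilon>' * norm w \<le> \<epsilon>' * (2 * c + s)" using \<epsilon>' by (intro mult_left_mono) auto
    also note \<epsilon>'(3)
    finally show "norm (poly F w - \<tau> * Ln (1 + w / \<tau>)) \<le> \<epsilon>" .
  qed
qed

section \<open>Estimates for polynomials, derivatives and the logarithm\<close>

lemma eventually_poly_dominates:
  fixes p q :: "'a :: real_normed_field poly" and B :: real
  assumes "degree q < degree p" "0 < B"
  shows "\<forall>\<^sub>F z in at_infinity. B * norm (poly q z) \<le> norm (poly p z)"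
proof -
  have "\<forall>\<^sub>F z in at_infinity. norm (poly q z / poly p z) < 1 / B"
    using poly_divide_tendsto_0_at_infinity[OF assms(1)] assms(2)
    by (intro order_tendstoD(2)[of _ 0] tendsto_norm_zero) auto
  moreover have "\<forall>\<^sub>F z in at_infinity. 1 \<le> norm (poly p z)"
    using filterlim_poly_at_infinity[of p] assms(1) by (simp add: filterlim_at_infinity[of 0])
  ultimately show ?thesis
  proof eventually_elim
    case (elim z)
    then have "0 < norm (poly p z)" by linarith
    then show ?case using elim(1) \<open>0 < B\<close> by (simp add: norm_divide field_simps)
  qed
qed

text \<open>This is Cauchy's estimate on the unit circle around \<open>z\<close>.\<close>

lemma norm_deriv_diff_le:
  assumes "f holomorphic_on UNIV" "g holomorphic_on UNIV"
    and "\<And>w. norm w \<le> norm z + 1 \<Longrightarrow> norm (f w - g w) \<le> B"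
  shows "norm (deriv f z - deriv g z) \<le> B"
proof -
  have hol: "(\<lambda>w. f w - g w) holomorphic_on S" for S
    by (rule holomorphic_on_subset[OF holomorphic_on_diff[OF assms(1,2)]]) simp
  have "norm ((deriv ^^ 1) (\<lambda>w. f w - g w) z) \<le> fact 1 * B / 1 ^ 1"
  proof (rule Cauchy_inequality)
    show "norm (f w - g w) \<le> B" if "norm (z - w) = 1" for w
      using that norm_triangle_ineq4[of z "z - w"] by (intro assms(3)) simp
  qed (auto intro!: hol holomorphic_on_imp_continuous_on)
  moreover have "f field_differentiable at z" "g field_differentiable at z"
    using assms(1,2) by (auto simp: holomorphic_on_def)
  ultimately show ?thesis by (simp add: deriv_diff)
qed

text \<open>\<open>Ln (1 + u) - u\<close> is quadratic in \<open>u = w / \<tau>\<close>, so after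
  multiplication by \<open>\<tau>\<close> the error is still of order \<open>1 / \<tau>\<close>.
  Large \<open>\<tau>\<close> therefore keeps the new polynomial close to the old one.\<close>

lemma norm_scaled_Ln_diff_le:
  fixes w :: complex and \<tau> M :: real
  assumes "0 < \<tau>" "2 * M \<le> \<tau>" "norm w \<le> M"
  shows "norm (\<tau> * Ln (1 + w / \<tau>) - w) \<le> 2 * M\<^sup>2 / \<tau>"
proof -
  define u where "u = w / \<tau>"
  have u: "norm u \<le> M / \<tau>" "norm u \<le> 1 / 2"
    using assms by (auto simp: u_def norm_divide field_simps)
  have "norm (Ln (1 + u) - u) \<le> (norm u)\<^sup>2 / (1 - norm u)"
    using u by (intro Ln_approx_linear) simp
  also have "\<dots> \<le> (norm u)\<^sup>2 / (1 / 2)"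
    using u by (intro divide_left_mono) auto
  also have "\<dots> \<le> 2 * (M / \<tau>)\<^sup>2"
    using u power_mono[of "norm u" "M / \<tau>" 2] by simp
  finally have "\<tau> * norm (Ln (1 + u) - u) \<le> \<tau> * (2 * (M / \<tau>)\<^sup>2)"
    using \<open>0 < \<tau>\<close> by (intro mult_left_mono) auto
  also have "\<dots> = 2 * M\<^sup>2 / \<tau>"
    using \<open>0 < \<tau>\<close> by (simp add: power2_eq_square)
  also have "\<tau> * norm (Ln (1 + u) - u) = norm (\<tau> * Ln (1 + u) - w)"
  proof -
    have "\<tau> * Ln (1 + u) - w = \<tau> * (Ln (1 + u) - u)"
      using \<open>0 < \<tau>\<close> by (simp add: u_def algebra_simps)
    then show ?thesis using \<open>0 < \<tau>\<close> by (simp add: norm_mult)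
  qed
  finally show ?thesis by (simp add: u_def)
qed

section \<open>One step of the construction\<close>

text \<open>The barrier is claimed for every entire \<open>G\<close> within \<open>1 / 2\<close> of
  \<open>Q\<close> on a ball, so that it survives all later corrections. The points with large
  derivative serve to show that the limit is transcendental.\<close>

lemma ex_poly_robust_barrier:
  fixes P :: "complex poly" and n :: nat and \<epsilon> :: real
  assumes "0 < degree P" "0 < \<epsilon>"
  obtains Q :: "complex poly" and R :: real where "0 < degree Q" "n \<le> R"
    "\<And>z. norm z \<le> n \<Longrightarrow> norm (poly Q z - poly P z) \<le> \<epsilon>"
    "\<And>G. G holomorphic_on UNIV \<Longrightarrow> (\<And>z. norm z \<le> R \<Longrightarrow> norm (G z - poly Q z) \<le> 1 / 2) \<Longrightarrow>
       slow_barrier n G \<and> (\<exists>z. 1 \<le> norm z \<and> n \<le> norm z \<and> norm z ^ n < norm (deriv G z))"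
proof -
  obtain M where M: "M > 0" "\<And>z. norm z \<le> n \<Longrightarrow> norm (poly P z) \<le> M"
    using poly_bound_exists[of "real n" P] by auto
  \<comment> \<open>\<open>s > 2 * M\<close> keeps the image of the disc of radius \<open>n\<close>
    to the right of \<open>Re w = - s / 2\<close>. The term \<open>6 * (n + 2)\<close> places that
    line to the left of \<open>- 2 * (n + 1)\<close>. In \<open>\<tau>\<close>, the last term makes
    the logarithm differ from the identity by at most \<open>\<epsilon> / 2\<close>.\<close>
  define s where "s = 2 * M + 6 * (n + 2)"
  define \<tau> where "\<tau> = s + 1 + 4 * M\<^sup>2 / \<epsilon>"
  have s: "s > 0" "s > 2 * M" "s \<ge> 6 * (real n + 2)" using M by (auto simp: s_def)
  have "4 * M\<^sup>2 / \<epsilon> > 0" using M assms by auto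
  then have \<tau>: "\<tau> > s" "\<tau> > 0" "\<tau> > 4 * M\<^sup>2 / \<epsilon>" using s by (auto simp: \<tau>_def)
  have "\<forall>\<^sub>F z in at_infinity. 8 * \<tau> * norm (poly (pderiv P) z) \<le> norm (poly P z)"
    using assms \<tau> by (intro eventually_poly_dominates) (auto simp: degree_pderiv)
  moreover have "\<forall>\<^sub>F z in at_infinity. 2 * \<tau> \<le> norm (poly P z)"
    using filterlim_poly_at_infinity[of P] assms \<tau> by (simp add: filterlim_at_infinity[of 0])
  ultimately have "\<forall>\<^sub>F z in at_infinity.
      8 * \<tau> * norm (poly (pderiv P) z) \<le> norm (poly P z) \<and> 2 * \<tau> \<le> norm (poly P z)"
    by (rule eventually_conj)
  then obtain \<rho>0 where \<rho>0: "\<And>z. \<rho>0 \<le> norm z \<Longrightarrow>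
      8 * \<tau> * norm (poly (pderiv P) z) \<le> norm (poly P z) \<and> 2 * \<tau> \<le> norm (poly P z)"
    unfolding eventually_at_infinity by blast
  define \<rho> where "\<rho> = max \<rho>0 n"
  have \<rho>: "\<rho> \<ge> n" "\<And>z. \<rho> \<le> norm z \<Longrightarrow> 8 * \<tau> * norm (poly (pderiv P) z) \<le> norm (poly P z)"
    "\<And>z. \<rho> \<le> norm z \<Longrightarrow> 2 * \<tau> \<le> norm (poly P z)"
    using \<rho>0 by (auto simp: \<rho>_def)
  obtain W where W: "W > 0" "\<And>z. norm z \<le> \<rho> + 1 \<Longrightarrow> norm (poly P z) \<le> W"
    using poly_bound_exists[of "\<rho> + 1" P] by auto
  \<comment> \<open>For \<open>c\<close> this large, the disc contains every \<open>w\<close> with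
    \<open>norm w \<le> W\<close> to the right of the line \<open>Re w = - s / 2\<close>; see
    \<open>D\<close>.\<close>
  define c where "c = W\<^sup>2 / s + 1"
  have c: "c > 0" "c * s \<ge> W\<^sup>2"
    using s by (auto simp: c_def distrib_right intro: add_nonneg_pos)
  \<comment> \<open>The three bounds serve closeness to \<open>P\<close>, a total error of 1 between
    \<open>G\<close> and \<open>L \<circ> P\<close>, and the estimate of \<open>F'\<close> in the
    annulus.\<close>
  define \<epsilon>' where "\<epsilon>' = min (\<epsilon> / 2) (min (1 / 2) (2 * \<tau> / W))"
  have \<epsilon>': "\<epsilon>' > 0" "\<epsilon>' \<le> \<epsilon> / 2" "\<epsilon>' \<le> 1 / 2" "\<epsilon>' \<le> 2 * \<tau> / W"
    using assms \<tau> W by (auto simp: \<epsilon>'_def)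
  define L where "L w = \<tau> * Ln (1 + w / \<tau>)" for w :: complex
  obtain F :: "complex poly" where F: "n + 1 < degree F"
    "\<And>w :: complex. w \<in> cball (of_real c) (c + s) \<Longrightarrow> norm (poly (pderiv F) w - \<tau> / (\<tau> + w)) \<le> \<epsilon>'"
    "\<And>w :: complex. w \<in> cball (of_real c) (c + s) \<Longrightarrow> norm (poly F w - L w) \<le> \<epsilon>'"
    unfolding L_def using ex_poly_approx_scaled_Ln[of c s \<tau> \<epsilon>' "n + 1"] c s \<tau> \<epsilon>' by (metis less_imp_le)
  have D: "w \<in> cball (of_real c) (c + s)" if "norm w \<le> W" "- (s / 2) \<le> Re w" for w :: complex
  proof -
    have "(norm (w - of_real c))\<^sup>2 = (norm w)\<^sup>2 - 2 * c * Re w + c\<^sup>2"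
      unfolding cmod_power2 by (simp add: power2_eq_square algebra_simps)
    also have "\<dots> \<le> (c + s)\<^sup>2"
    proof -
      have "(norm w)\<^sup>2 \<le> W\<^sup>2" using that by (intro power_mono) auto
      moreover have "c * (- (s / 2)) \<le> c * Re w" using c that by (intro mult_left_mono) auto
      moreover have "0 \<le> s\<^sup>2" by simp
      ultimately show ?thesis using c(2) unfolding power2_sum by argo
    qed
    finally have "norm (w - of_real c) \<le> c + s"
      using c s by (auto intro: power2_le_imp_le)
    then show ?thesis by (simp add: dist_norm norm_minus_commute)
  qed
  define Q where "Q = pcompose F P"
  have "degree Q = degree F * degree P" by (simp add: Q_def degree_pcompose)
  also have "\<dots> \<ge> degree F * 1" using assms by (intro mult_le_mono) auto
  finally have degQ: "n + 1 < degree Q" using F(1) by linarith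
  \<comment> \<open>The factor 2 absorbs the error \<open>1 / 2\<close> in passing from
    \<open>Q'\<close> to the derivative of \<open>G\<close>.\<close>
  then have "degree (monom 2 n :: complex poly) < degree (pderiv Q)"
    by (simp add: degree_pderiv degree_monom_eq)
  from eventually_poly_dominates[OF this zero_less_one] obtain b
    where b: "\<And>z. b \<le> norm z \<Longrightarrow> 2 * norm z ^ n \<le> norm (poly (pderiv Q) z)"
    unfolding eventually_at_infinity by (auto simp: poly_monom norm_mult norm_power)
  define z0 where "z0 = complex_of_real (max b (max 1 (real n)))"
  then have z0: "norm z0 = max b (max 1 (real n))"
    by (simp add: abs_of_nonneg)
  \<comment> \<open>The final \<open>+ 1\<close> leaves room for Cauchy's estimate on the annulus
    and at \<open>z0\<close>.\<close>
  define R where "R = max (\<rho> + 1) (norm z0) + 1"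
  show thesis
  proof (rule that)
    show "0 < degree Q" using degQ by simp
    show "real n \<le> R" using \<rho>(1) by (simp add: R_def)
  next
    fix z :: complex assume z: "norm z \<le> n"
    define w where "w = poly P z"
    have w: "norm w \<le> M" "norm w \<le> W" "- (s / 2) \<le> Re w"
      using M(2)[OF z] W(2)[of z] z \<rho>(1) s abs_Re_le_cmod[of w] by (auto simp: w_def)
    have "norm (poly F w - L w) \<le> \<epsilon> / 2" using F(3)[OF D] w \<epsilon>' by force
    moreover have "norm (L w - w) \<le> 2 * M\<^sup>2 / \<tau>"
      unfolding L_def using \<tau> s w by (intro norm_scaled_Ln_diff_le) auto
    moreover have "2 * M\<^sup>2 / \<tau> \<le> \<epsilon> / 2" using \<tau> assms by (simp add: field_simps)
    ultimately have "norm (poly F w - w) \<le> \<epsilon>"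
      using norm_triangle_ineq[of "poly F w - L w" "L w - w"] by simp
    then show "norm (poly Q z - poly P z) \<le> \<epsilon>" by (simp add: Q_def w_def poly_pcompose)
  next
    fix G assume G: "G holomorphic_on UNIV" "\<And>z. norm z \<le> R \<Longrightarrow> norm (G z - poly Q z) \<le> 1 / 2"
    have G': "norm (deriv G z - poly (pderiv Q) z) \<le> 1 / 2" if "norm z + 1 \<le> R" for z
    proof -
      have "norm (deriv G z - deriv (poly Q) z) \<le> 1 / 2"
        using G that by (intro norm_deriv_diff_le) (auto intro!: holomorphic_intros)
      then show ?thesis using DERIV_imp_deriv[OF poly_DERIV] by metis
    qed
    define h where "h z = Re (poly P z) + s / 2" for z
    have "slow_barrier n G"
      unfolding slow_barrier_def
    proof (intro exI conjI allI impI)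
      show "continuous_on UNIV h" unfolding h_def by (intro continuous_intros)
      show "real n \<le> \<rho>" by fact
      show "h z > 0" if "norm z \<le> n" for z
        using M(2)[OF that] s abs_Re_le_cmod[of "poly P z"] by (simp add: h_def)
    next
      fix z assume z: "norm z \<le> \<rho> + 1" "h z = 0" "\<bar>Im (G z)\<bar> \<le> n"
      define w where "w = poly P z"
      have Re_w: "Re w = - (s / 2)" using z(2) by (simp add: h_def w_def)
      have "norm (poly F w - L w) \<le> 1 / 2"
        using F(3)[OF D, of w] W(2)[OF z(1)] Re_w \<epsilon>' by (simp add: w_def)
      moreover have "norm (G z - poly F w) \<le> 1 / 2"
        using G(2)[of z] z by (simp add: R_def Q_def w_def poly_pcompose)
      ultimately have GL: "norm (G z - L w) \<le> 1"
        using norm_triangle_ineq[of "G z - poly F w" "poly F w - L w"] by simp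
      show "Re (G z) < - real n"
      \<comment> \<open>Since \<open>L w\<close> is within 1 of \<open>G z\<close>, its imaginary
        and real parts obey the bounds with \<open>n + 1\<close>. Then
        \<open>Re w \<ge> - 2 * (n + 1)\<close>, whereas
        \<open>Re w = - s / 2 \<le> - 3 * (n + 2)\<close>.\<close>
      proof (rule ccontr)
        assume "\<not> Re (G z) < - real n"
        then have "- (2 * (real n + 1)) \<le> Re w"
        proof (intro Re_ge_of_scaled_Ln[where \<tau> = \<tau>])
          have "0 < Re (1 + w / \<tau>)" using Re_w \<tau> s by (simp add: field_simps)
          then show "1 + w / \<tau> \<noteq> 0" by (metis less_irrefl zero_complex.simps(1))
          show "\<bar>Im (\<tau> * Ln (1 + w / \<tau>))\<bar> \<le> real n + 1"
            using GL z(3) abs_Im_le_cmod[of "G z - L w"] unfolding L_def[symmetric] by simp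
          show "- (real n + 1) \<le> Re (\<tau> * Ln (1 + w / \<tau>))"
            using GL \<open>\<not> Re (G z) < - real n\<close> abs_Re_le_cmod[of "G z - L w"]
            unfolding L_def[symmetric] by simp
        qed (use \<tau> s in auto)
        then show False using Re_w s by simp
      qed
    next
      fix z assume z: "\<rho> \<le> norm z" "norm z \<le> \<rho> + 1" "0 \<le> h z"
      define w where "w = poly P z"
      have w: "norm w \<le> W" "- (s / 2) \<le> Re w" "2 * \<tau> \<le> norm w"
        and P': "norm (poly (pderiv P) z) \<le> norm w / (8 * \<tau>)"
        using W(2)[OF z(2)] z(3) \<rho>(2,3)[OF z(1)] \<tau>(2) by (auto simp: w_def h_def field_simps)
      have "norm w / 2 \<le> norm (\<tau> + w)"
        using w(3) norm_triangle_ineq2[of w "- of_real \<tau>"] \<tau>(2) by (simp add: add.commute)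
      then have "\<tau> / norm (\<tau> + w) \<le> \<tau> / (norm w / 2)"
        using \<tau>(2) w(3) by (intro frac_le) auto
      then have "norm (\<tau> / (\<tau> + w)) \<le> 2 * \<tau> / norm w"
        using \<tau>(2) by (simp add: norm_divide mult.commute)
      \<comment> \<open>The logarithm and the approximation error each contribute at most
        \<open>2 * \<tau> / norm w\<close>. The factor 8 in the choice of \<open>\<rho>0\<close>
        turns the product with \<open>P'\<close> into \<open>1 / 2\<close>.\<close>
      then have "norm (poly (pderiv F) w) \<le> 2 * \<tau> / norm w + 2 * \<tau> / W"
        using F(2)[OF D[OF w(1,2)]] \<epsilon>'(4) norm_triangle_sub[of "poly (pderiv F) w" "\<tau> / (\<tau> + w)"] by simp
      also have "\<dots> \<le> 4 * \<tau> / norm w"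
      proof -
        have "2 * \<tau> / W \<le> 2 * \<tau> / norm w" using w \<tau>(2) by (intro frac_le) auto
        then have "2 * \<tau> / norm w + 2 * \<tau> / W \<le> 2 * \<tau> / norm w + 2 * \<tau> / norm w" by simp
        also have "\<dots> = 4 * \<tau> / norm w" by (simp flip: add_divide_distrib)
        finally show ?thesis .
      qed
      finally have "norm (poly (pderiv F) w) * norm (poly (pderiv P) z) \<le> 4 * \<tau> / norm w * (norm w / (8 * \<tau>))"
        using P' \<tau>(2) by (intro mult_mono) auto
      also have "\<dots> = 1 / 2" using w(3) \<tau>(2) by (auto simp: field_simps)
      finally have "norm (poly (pderiv Q) z) \<le> 1 / 2"
        by (simp add: Q_def w_def pderiv_pcompose poly_pcompose norm_mult)
      moreover have "norm (deriv G z - poly (pderiv Q) z) \<le> 1 / 2"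
        using z by (intro G') (simp add: R_def)
      ultimately show "norm (deriv G z) \<le> 1"
        using norm_triangle_sub[of "deriv G z" "poly (pderiv Q) z"] by linarith
    qed
    moreover have "norm z0 ^ n < norm (deriv G z0)"
    proof -
      have "1 \<le> norm z0 ^ n" using z0 by (intro one_le_power) simp
      moreover have "2 * norm z0 ^ n \<le> norm (poly (pderiv Q) z0)" using z0 by (intro b) simp
      moreover have "norm (deriv G z0 - poly (pderiv Q) z0) \<le> 1 / 2" by (rule G') (simp add: R_def)
      ultimately show ?thesis
        using norm_triangle_ineq2[of "poly (pderiv Q) z0" "deriv G z0"]
          norm_minus_commute[of "deriv G z0" "poly (pderiv Q) z0"] by linarith
    qed
    moreover have "1 \<le> norm z0" "n \<le> norm z0" using z0 by auto
    ultimately show "slow_barrier n G \<and> (\<exists>z. 1 \<le> norm z \<and> n \<le> norm z \<and> norm z ^ n < norm (deriv G z))"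
      by blast
  qed
qed

section \<open>The entire limit and its transcendence\<close>

text \<open>The corrections from \<open>k\<close> on sum to \<open>(1 / 2) ^ (k + 1)\<close>, and
  monotonicity of \<open>R\<close> makes all of them effective on the ball of radius
  \<open>R k\<close>. These balls exhaust the plane, so convergence is locally uniform.\<close>

lemma ex_entire_limit:
  fixes f :: "nat \<Rightarrow> complex \<Rightarrow> complex" and R :: "nat \<Rightarrow> real"
  assumes hol: "\<And>k. f k holomorphic_on UNIV" and R: "mono R" "\<And>k. real k \<le> R k"
    and step: "\<And>k z. norm z \<le> R k \<Longrightarrow> norm (f (Suc k) z - f k z) \<le> (1 / 2) ^ (k + 2)"
  obtains G where "G holomorphic_on UNIV" "\<And>k z. norm z \<le> R k \<Longrightarrow> norm (G z - f k z) \<le> (1 / 2) ^ (k + 1)"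
proof -
  \<comment> \<open>The bound is the exact partial sum of the geometric series, which lets the
    induction close.\<close>
  have diff: "norm (f (k + i) z - f k z) \<le> (1 / 2) ^ (k + 1) - (1 / 2) ^ (k + i + 1)" if "norm z \<le> R k" for k i z
  proof (induction i)
    case (Suc i)
    have "norm z \<le> R (k + i)" using that monoD[OF R(1), of k "k + i"] by simp
    then have "norm (f (Suc (k + i)) z - f (k + i) z) \<le> (1 / 2) ^ (k + i + 2)" by (rule step)
    then show ?case
      using Suc norm_triangle_ineq[of "f (Suc (k + i)) z - f (k + i) z" "f (k + i) z - f k z"] by simp
  qed simp
  have bound: "norm (f m z - f k z) \<le> (1 / 2) ^ (k + 1)" if "norm z \<le> R k" "k \<le> m" for k m z
  proof -
    have "0 \<le> (1 / 2 :: real) ^ (m + 1)" by simp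
    moreover have "k + (m - k) = m" using that(2) by simp
    ultimately show ?thesis using diff[OF that(1), of "m - k"] by (smt (verit))
  qed
  have conv: "convergent (\<lambda>k. f k z)" for z
  proof (rule Cauchy_convergent, rule metric_CauchyI)
    fix e :: real assume "e > 0"
    then obtain j where j: "(1 / 2) ^ j < e / 2" using real_arch_pow_inv[of "e / 2" "1 / 2"] by auto
    obtain i where i: "norm z \<le> real i" using real_arch_simple by blast
    define k where "k = max i j"
    have "norm z \<le> R k" using i R(2)[of k] by (simp add: k_def)
    have "(1 / 2) ^ (k + 1) \<le> (1 / 2 :: real) ^ j" by (intro power_decreasing) (auto simp: k_def)
    then have near: "dist (f m z) (f k z) < e / 2" if "k \<le> m" for m
      using bound[OF \<open>norm z \<le> R k\<close> that] j by (simp add: dist_norm)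
    show "\<exists>M. \<forall>m\<ge>M. \<forall>n\<ge>M. dist (f m z) (f n z) < e"
      using near dist_triangle_half_l by (metis dist_commute)
  qed
  define G where "G z = lim (\<lambda>k. f k z)" for z
  have G: "norm (G z - f k z) \<le> (1 / 2) ^ (k + 1)" if "norm z \<le> R k" for k z
  proof (rule Lim_norm_ubound[OF sequentially_bot])
    show "(\<lambda>m. f m z - f k z) \<longlonglongrightarrow> G z - f k z"
      using conv[of z] unfolding G_def convergent_LIMSEQ_iff by (intro tendsto_diff) auto
    show "\<forall>\<^sub>F m in sequentially. norm (f m z - f k z) \<le> (1 / 2) ^ (k + 1)"
      using eventually_ge_at_top[of k] by eventually_elim (rule bound[OF that])
  qed
  have "G holomorphic_on UNIV"
  proof (rule holomorphic_uniform_sequence[OF open_UNIV hol])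
    fix x :: complex
    have "uniform_limit (cball x 1) f G sequentially"
      unfolding uniform_limit_iff
    proof (intro allI impI)
      fix e :: real assume "e > 0"
      then obtain j where j: "(1 / 2) ^ j < e" using real_arch_pow_inv[of e "1 / 2"] by auto
      obtain i where i: "norm x + 1 \<le> real i" using real_arch_simple by blast
      have "dist (f k z) (G z) < e" if "max i j \<le> k" "z \<in> cball x 1" for k z
      proof -
        have "norm z \<le> R k"
          using that i R(2)[of k] norm_triangle_sub[of z x] by (simp add: dist_norm norm_minus_commute)
        moreover have "(1 / 2) ^ (k + 1) \<le> (1 / 2 :: real) ^ j" using that by (intro power_decreasing) auto
        ultimately show ?thesis using G[of z k] j by (simp add: dist_norm norm_minus_commute)
      qed
      then show "\<forall>\<^sub>F k in sequentially. \<forall>z\<in>cball x 1. dist (f k z) (G z) < e"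
        unfolding eventually_sequentially by blast
    qed
    then show "\<exists>d>0. cball x d \<subseteq> UNIV \<and> uniform_limit (cball x d) f G sequentially"
      by (intro exI[of _ 1]) simp
  qed
  then show thesis using G by (rule that)
qed

text \<open>A polynomial of degree \<open>d\<close> is eventually bounded by
  \<open>norm z ^ Suc d\<close>. The hypothesis with \<open>n \<ge> Suc d\<close> contradicts this,
  as \<open>norm z \<ge> n\<close> pushes \<open>z\<close> beyond any threshold.\<close>

lemma superpolynomial_imp_not_poly:
  fixes g :: "complex \<Rightarrow> complex"
  assumes "\<And>m. \<exists>n\<ge>m. \<exists>z. 1 \<le> norm z \<and> real n \<le> norm z \<and> norm z ^ n < norm (g z)"
  shows "\<not> (\<exists>p. \<forall>z. g z = poly p z)"
proof
  assume "\<exists>p. \<forall>z. g z = poly p z"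
  then obtain p where p: "\<And>z. g z = poly p z" by blast
  have "degree p < degree (monom 1 (Suc (degree p)) :: complex poly)"
    by (simp add: degree_monom_eq)
  from eventually_poly_dominates[OF this zero_less_one] obtain b
    where b: "\<And>z. b \<le> norm z \<Longrightarrow> norm (poly p z) \<le> norm z ^ Suc (degree p)"
    unfolding eventually_at_infinity by (auto simp: poly_monom norm_mult norm_power)
  obtain i where i: "b \<le> real i" using real_arch_simple by blast
  obtain n z where n: "max i (Suc (degree p)) \<le> n"
    and z: "1 \<le> norm z" "real n \<le> norm z" "norm z ^ n < norm (g z)"
    using assms by blast
  have "norm (g z) \<le> norm z ^ Suc (degree p)"
    using b[of z] i n z(2) by (simp add: p)
  also have "\<dots> \<le> norm z ^ n" using n z(1) by (intro power_increasing) auto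
  finally show False using z(3) by simp
qed

text \<open>Triples of a polynomial, a barrier index and a radius of robustness are chosen
  recursively. Later corrections on each such ball sum to at most \<open>1 / 2\<close>, the
  tolerance of the barrier, so the limit inherits every barrier.\<close>

lemma ex_entire_with_barriers:
  obtains G where "G holomorphic_on UNIV"
    "\<And>m. \<exists>n\<ge>m. slow_barrier n G \<and> (\<exists>z. 1 \<le> norm z \<and> real n \<le> norm z \<and> norm z ^ n < norm (deriv G z))"
proof -
  define robust where "robust Q n R \<longleftrightarrow> (\<forall>G. G holomorphic_on UNIV \<longrightarrow>
      (\<forall>z. norm z \<le> R \<longrightarrow> norm (G z - poly Q z) \<le> 1 / 2) \<longrightarrow>
      slow_barrier n G \<and> (\<exists>z. 1 \<le> norm z \<and> n \<le> norm z \<and> norm z ^ n < norm (deriv G z)))"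
    for Q :: "complex poly" and n :: nat and R :: real
  define good where "good k x \<longleftrightarrow> (case x of (Q, n, R) \<Rightarrow> 0 < degree Q \<and> k \<le> n \<and> real n \<le> R \<and> robust Q n R)"
    for k :: nat and x :: "complex poly \<times> nat \<times> real"
  \<comment> \<open>\<open>R \<le> n'\<close> makes each new polynomial close to its predecessor on
    the whole ball where the predecessor's barrier needs control.\<close>
  define close where "close k x y \<longleftrightarrow> (case x of (Q, n, R) \<Rightarrow> case y of (Q', n', R') \<Rightarrow> R \<le> real n' \<and>
      (\<forall>z. norm z \<le> n' \<longrightarrow> norm (poly Q' z - poly Q z) \<le> (1 / 2) ^ (k + 2)))"
    for k :: nat and x y :: "complex poly \<times> nat \<times> real"
  have "\<exists>y. good (Suc k) y \<and> close k x y" if "good k x" for k x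
  proof -
    obtain Q n R where x: "x = (Q, n, R)" by (cases x)
    obtain m where m: "max R (Suc k) \<le> real m" using real_arch_simple by blast
    have "0 < degree Q" using that by (simp add: good_def x)
    moreover have "0 < (1 / 2 :: real) ^ (k + 2)" by simp
    ultimately obtain Q' R' where "0 < degree Q'" "real m \<le> R'"
      "\<And>z. norm z \<le> m \<Longrightarrow> norm (poly Q' z - poly Q z) \<le> (1 / 2) ^ (k + 2)" "robust Q' m R'"
      unfolding robust_def using ex_poly_robust_barrier[of Q "(1 / 2) ^ (k + 2)" m] by metis
    with m have "good (Suc k) (Q', m, R') \<and> close k x (Q', m, R')"
      by (simp add: good_def close_def x)
    then show ?thesis by blast
  qed
  moreover have "\<exists>x. good 0 x"
  proof -
    have deg: "0 < degree [:0, 1 :: complex:]" by simp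
    obtain Q R where "0 < degree Q" "real 0 \<le> R" "robust Q 0 R"
    proof (rule ex_poly_robust_barrier[OF deg zero_less_one, of 0])
      fix Q R
      assume "0 < degree Q" "real 0 \<le> R" and *: "\<And>G. G holomorphic_on UNIV \<Longrightarrow>
        (\<And>z. norm z \<le> R \<Longrightarrow> norm (G z - poly Q z) \<le> 1 / 2) \<Longrightarrow>
        slow_barrier 0 G \<and> (\<exists>z. 1 \<le> norm z \<and> real 0 \<le> norm z \<and> norm z ^ 0 < norm (deriv G z))"
      moreover have "robust Q 0 R" unfolding robust_def by (intro allI impI *) blast+
      ultimately show thesis by (intro that)
    qed
    then have "good 0 (Q, 0, R)" by (simp add: good_def)
    then show ?thesis by blast
  qed
  ultimately obtain F where F: "\<And>k. good k (F k)" "\<And>k. close k (F k) (F (Suc k))"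
    using dependent_nat_choice[of good close] by blast
  define Q n R where "Q k = fst (F k)" "n k = fst (snd (F k))" "R k = snd (snd (F k))" for k
  have F_eq: "F k = (Q k, n k, R k)" for k by (simp add: Q_n_R_def)
  have good: "k \<le> n k" "real (n k) \<le> R k" "robust (Q k) (n k) (R k)" for k
    using F(1)[of k] by (auto simp: good_def F_eq)
  have close: "R k \<le> real (n (Suc k))"
    "norm z \<le> n (Suc k) \<Longrightarrow> norm (poly (Q (Suc k)) z - poly (Q k) z) \<le> (1 / 2) ^ (k + 2)" for k z
    using F(2)[of k] by (auto simp: close_def F_eq)
  obtain G where G: "G holomorphic_on UNIV"
    "\<And>k z. norm z \<le> R k \<Longrightarrow> norm (G z - poly (Q k) z) \<le> (1 / 2) ^ (k + 1)"
  proof (rule ex_entire_limit[of "\<lambda>k. poly (Q k)" R])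
    show "mono R" using close(1) good(2) by (intro mono_iff_le_Suc[THEN iffD2] allI) (meson order_trans)
    show "real k \<le> R k" for k using good(1,2)[of k] by linarith
    show "norm (poly (Q (Suc k)) z - poly (Q k) z) \<le> (1 / 2) ^ (k + 2)" if "norm z \<le> R k" for k z
      using that close(1)[of k] by (intro close(2)) simp
  qed (auto intro!: holomorphic_intros)
  show thesis
  proof (rule that[OF G(1)])
    fix m
    have "(1 / 2) ^ (m + 1) \<le> (1 / 2 :: real)" by (simp add: power_le_one)
    then have "norm (G z - poly (Q m) z) \<le> 1 / 2" if "norm z \<le> R m" for z
      using G(2)[OF that] by linarith
    then show "\<exists>n\<ge>m. slow_barrier n G \<and> (\<exists>z. 1 \<le> norm z \<and> real n \<le> norm z \<and> norm z ^ n < norm (deriv G z))"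
      using good(1,3)[of m] G(1) unfolding robust_def by blast
  qed
qed

theorem theorem1p3:
  shows "\<exists>g. transcendental_entire g \<and>
           (\<forall>z a b. trajectory g z a b \<longrightarrow> \<not> escapes_in_finite_time z b)"
proof -
  obtain G where G: "G holomorphic_on UNIV"
    "\<And>m. \<exists>n\<ge>m. slow_barrier n G \<and> (\<exists>z. 1 \<le> norm z \<and> real n \<le> norm z \<and> norm z ^ n < norm (deriv G z))"
    using ex_entire_with_barriers by blast
  have "transcendental_entire (deriv G)"
    unfolding transcendental_entire_def
    using G by (intro conjI holomorphic_deriv superpolynomial_imp_not_poly) blast+
  moreover have "\<not> escapes_in_finite_time z b" if "trajectory (deriv G) z a b" for z a b
    using that G unfolding trajectory_def by (meson slow_barriers_imp_not_escape)
  ultimately show ?thesis by blast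
qed

end
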